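(* Let $\mathcal{Q}$ and $\mathcal{Q}'$ be seminormal quasi-crystals of type $A_{n-1}$ satisfying the local quasi-crystal axioms LQ1, LQ2, LQ3, LQ3$'$. Then the quasi-tensor product $\mathcal{Q}\mathbin{\ddot\otimes}\mathcal{Q}'$ satisfies the same axioms.
   Context: Fix $n\ge 2$, $I=\{1,\dots,n-1\}$, weights in $\mathbb{Z}^n$ with standard inner product, $\alpha_i=\mathbf{e}_i-\mathbf{e}_{i+1}$; on $\mathbb{Z}\sqcup\{\pm\infty\}$, $m+(\pm\infty)=\pm\infty$. A quasi-crystal of type $A_{n-1}$ is a non-empty set $\mathcal{Q}$ with maps $\ddot e_i,\ddot f_i:\mathcal{Q}\to\mathcal{Q}\sqcup\{\bot\}$, $\ddot\varepsilon_i,\ddot\varphi_i:\mathcal{Q}\to\mathbb{Z}\sqcup\{\pm\infty\}$, $\mathrm{wt}:\mathcal{Q}\to\mathbb{Z}^n$ with: (Q1) $\ddot e_i(x)=y\iff x=\ddot f_i(y)$, and then $\mathrm{wt}(y)=\mathrm{wt}(x)+\alpha_i$, $\ddot\varepsilon_i(y)=\ddot\varepsilon_i(x)-1$, $\ddot\varphi_i(y)=\ddot\varphi_i(x)+1$; (Q2) $\ddot\varphi_i(x)=\ddot\varepsilon_i(x)+\langle\mathrm{wt}(x),\alpha_i\rangle$; (Q3),(Q4) if $\ddot\varepsilon_i(x)=\pm\infty$ then $\ddot e_i(x)=\ddot f_i(x)=\bot$. Seminormal: whenever $\ddot\varepsilon_i(x)\ne+\infty$, $\ddot\varepsilon_i(x)=\max\{k:\ddot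 e_i^k(x)\ne\bot\}$ and $\ddot\varphi_i(x)=\max\{k:\ddot f_i^k(x)\ne\bot\}$. Local axioms (all $i,j\in I$, $x,y$): (LQ1) for $i+1\in I$: $\ddot\varepsilon_i(x)=0\iff\ddot\varphi_{i+1}(x)=0$. (LQ2) if $\ddot e_i(x)=y$: (1) $\ddot\varepsilon_j(x)=\ddot\varepsilon_j(y)$ for $|i-j|>1$; (2) if $i+1\in I$: $\ddot\varepsilon_{i+1}(x)\ne\ddot\varepsilon_{i+1}(y)$ iff ($\ddot\varepsilon_{i+1}(x)=+\infty$ and $\ddot\varepsilon_i(y)=0$), and then $\ddot\varepsilon_{i+1}(y)\ne0$; (3) if $i-1\in I$: $\ddot\varphi_{i-1}(x)\ne\ddot\varphi_{i-1}(y)$ iff ($\ddot\varphi_{i-1}(y)=+\infty$ and $\ddot\varphi_i(x)=0$), and then $\ddot\varphi_{i-1}(x)\ne0$. (LQ3) for $i\ne j$, if $\ddot e_i(x)\ne\bot\ne\ddot e_j(x)$ then $\ddot e_i\ddot e_j(x)=\ddot e_j\ddot e_i(x)\ne\bot$. (LQ3$'$) same with $\ddot f$. Quasi-tensor product: $\mathcal{Q}\mathbin{\ddot\otimes}\mathcal{Q}'$ is the set of pairs $x\mathbin{\ddot\otimes}x'$ ($x\in\mathcal{Q}$, $x'\in\mathcal{Q}'$) with $\mathrm{wt}(x\mathbin{\ddot\otimes}x')=\mathrm{wt}(x)+\mathrm{wt}(x')$ and, for each $i$: if $\ddot\varphi_i(x)>0$ and $\ddot\varepsilon_i(x')>0$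 then $\ddot e_i(x\mathbin{\ddot\otimes}x')=\ddot f_i(x\mathbin{\ddot\otimes}x')=\bot$ and $\ddot\varepsilon_i(x\mathbin{\ddot\otimes}x')=\ddot\varphi_i(x\mathbin{\ddot\otimes}x')=+\infty$; otherwise $\ddot e_i(x\mathbin{\ddot\otimes}x')=\ddot e_i(x)\mathbin{\ddot\otimes}x'$ if $\ddot\varphi_i(x)\ge\ddot\varepsilon_i(x')$ and $=x\mathbin{\ddot\otimes}\ddot e_i(x')$ if $\ddot\varphi_i(x)<\ddot\varepsilon_i(x')$; $\ddot f_i(x\mathbin{\ddot\otimes}x')=\ddot f_i(x)\mathbin{\ddot\otimes}x'$ if $\ddot\varphi_i(x)>\ddot\varepsilon_i(x')$ and $=x\mathbin{\ddot\otimes}\ddot f_i(x')$ if $\ddot\varphi_i(x)\le\ddot\varepsilon_i(x')$; $\ddot\varepsilon_i(x\mathbin{\ddot\otimes}x')=\max\{\ddot\varepsilon_i(x),\ddot\varepsilon_i(x')-\langle\mathrm{wt}(x),\alpha_i\rangle\}$ and $\ddot\varphi_i(x\mathbin{\ddot\otimes}x')=\max\{\ddot\varphi_i(x)+\langle\mathrm{wt}(x'),\alpha_i\rangle,\ddot\varphi_i(x')\}$; here $x\mathbin{\ddot\otimes}\bot=\bot\mathbin{\ddot\otimes}x'=\bot$. This is a seminormal quasi-crystal of type $A_{n-1}$. *)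

theory Defs
  imports "HOL-Library.Extended"
begin

text \<open>
  The lattice \<open>\<int>\<^sup>n\<close> is represented by the functions \<^typ>\<open>nat \<Rightarrow> int\<close> that vanish outside
  \<open>{1..n}\<close>; the set \<open>\<int> \<squnion> {\<plusminus>\<infinity>}\<close> is the library type \<^typ>\<open>int extended\<close>; the extra
  element \<open>\<bottom>\<close> is \<^const>\<open>None\<close>.
\<close>

definition weight_lattice :: "nat \<Rightarrow> (nat \<Rightarrow> int) set" where
  "weight_lattice n = {v. \<forall>k. k \<notin> {1..n} \<longrightarrow> v k = 0}"

definition weight_inner :: "nat \<Rightarrow> (nat \<Rightarrow> int) \<Rightarrow> (nat \<Rightarrow> int) \<Rightarrow> int" where
  "weight_inner n u v = (\<Sum>k = 1..n. u k * v k)"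

definition unit_weight :: "nat \<Rightarrow> nat \<Rightarrow> int" where
  "unit_weight i = (\<lambda>k. if k = i then 1 else 0)"

definition simple_root :: "nat \<Rightarrow> nat \<Rightarrow> int" where
  "simple_root i = (\<lambda>k. unit_weight i k - unit_weight (i + 1) k)"

abbreviation index_set :: "nat \<Rightarrow> nat set" where
  "index_set n \<equiv> {1..n - 1}"

record 'a qc_data =
  qset :: "'a set"
  qe :: "nat \<Rightarrow> 'a \<Rightarrow> 'a option"
  qf :: "nat \<Rightarrow> 'a \<Rightarrow> 'a option"
  qeps :: "nat \<Rightarrow> 'a \<Rightarrow> int extended"
  qphi :: "nat \<Rightarrow> 'a \<Rightarrow> int extended"
  qwt :: "'a \<Rightarrow> nat \<Rightarrow> int"

locale quasi_crystal =
  fixes n :: nat and Q :: "'a qc_data"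
  assumes nonempty: "qset Q \<noteq> {}"
    and e_closed: "\<lbrakk>i \<in> index_set n; x \<in> qset Q; qe Q i x = Some y\<rbrakk> \<Longrightarrow> y \<in> qset Q"
    and f_closed: "\<lbrakk>i \<in> index_set n; x \<in> qset Q; qf Q i x = Some y\<rbrakk> \<Longrightarrow> y \<in> qset Q"
    and wt_closed: "x \<in> qset Q \<Longrightarrow> qwt Q x \<in> weight_lattice n"
    and Q1_iff: "\<lbrakk>i \<in> index_set n; x \<in> qset Q; y \<in> qset Q\<rbrakk>
      \<Longrightarrow> qe Q i x = Some y \<longleftrightarrow> qf Q i y = Some x"
    and Q1_wt: "\<lbrakk>i \<in> index_set n; x \<in> qset Q; y \<in> qset Q; qe Q i x = Some y\<rbrakk>
      \<Longrightarrow> qwt Q y = (\<lambda>k. qwt Q x k + simple_root i k)"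
    and Q1_eps: "\<lbrakk>i \<in> index_set n; x \<in> qset Q; y \<in> qset Q; qe Q i x = Some y\<rbrakk>
      \<Longrightarrow> qeps Q i y = qeps Q i x - 1"
    and Q1_phi: "\<lbrakk>i \<in> index_set n; x \<in> qset Q; y \<in> qset Q; qe Q i x = Some y\<rbrakk>
      \<Longrightarrow> qphi Q i y = qphi Q i x + 1"
    and Q2: "\<lbrakk>i \<in> index_set n; x \<in> qset Q\<rbrakk>
      \<Longrightarrow> qphi Q i x = qeps Q i x + Fin (weight_inner n (qwt Q x) (simple_root i))"
    and Q3: "\<lbrakk>i \<in> index_set n; x \<in> qset Q; qeps Q i x = Minf\<rbrakk>
      \<Longrightarrow> qe Q i x = None \<and> qf Q i x = None"
    and Q4: "\<lbrakk>i \<in> index_set n; x \<in> qset Q; qeps Q i x = Pinf\<rbrakk>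
      \<Longrightarrow> qe Q i x = None \<and> qf Q i x = None"

definition partial_iter :: "('a \<Rightarrow> 'a option) \<Rightarrow> nat \<Rightarrow> 'a \<Rightarrow> 'a option" where
  "partial_iter g k x = ((\<lambda>z. Option.bind z g) ^^ k) (Some x)"

text \<open>
  \<^const>\<open>Max\<close> is unspecified on infinite sets, so existence of the maxima (over sets that contain
  \<open>0\<close>) is expressed by requiring finiteness.
\<close>

locale seminormal_quasi_crystal = quasi_crystal n Q for n :: nat and Q :: "'a qc_data" +
  assumes seminormal_eps: "\<lbrakk>i \<in> index_set n; x \<in> qset Q; qeps Q i x \<noteq> Pinf\<rbrakk>
      \<Longrightarrow> finite {k. partial_iter (qe Q i) k x \<noteq> None}
        \<and> qeps Q i x = Fin (int (Max {k. partial_iter (qe Q i) k x \<noteq> None}))"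
    and seminormal_phi: "\<lbrakk>i \<in> index_set n; x \<in> qset Q; qeps Q i x \<noteq> Pinf\<rbrakk>
      \<Longrightarrow> finite {k. partial_iter (qf Q i) k x \<noteq> None}
        \<and> qphi Q i x = Fin (int (Max {k. partial_iter (qf Q i) k x \<noteq> None}))"

definition LQ1 :: "nat \<Rightarrow> 'a qc_data \<Rightarrow> bool" where
  "LQ1 n Q \<longleftrightarrow> (\<forall>i \<in> index_set n. \<forall>x \<in> qset Q. i + 1 \<in> index_set n \<longrightarrow>
     (qeps Q i x = 0 \<longleftrightarrow> qphi Q (i + 1) x = 0))"

definition LQ2 :: "nat \<Rightarrow> 'a qc_data \<Rightarrow> bool" where
  "LQ2 n Q \<longleftrightarrow> (\<forall>i \<in> index_set n. \<forall>x \<in> qset Q. \<forall>y \<in> qset Q. qe Q i x = Some y \<longrightarrow>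
     (\<forall>j \<in> index_set n. \<bar>int i - int j\<bar> > 1 \<longrightarrow> qeps Q j x = qeps Q j y) \<and>
     (i + 1 \<in> index_set n \<longrightarrow>
       (qeps Q (i + 1) x \<noteq> qeps Q (i + 1) y \<longleftrightarrow> qeps Q (i + 1) x = Pinf \<and> qeps Q i y = 0) \<and>
       (qeps Q (i + 1) x \<noteq> qeps Q (i + 1) y \<longrightarrow> qeps Q (i + 1) y \<noteq> 0)) \<and>
     (i - 1 \<in> index_set n \<longrightarrow>
       (qphi Q (i - 1) x \<noteq> qphi Q (i - 1) y \<longleftrightarrow> qphi Q (i - 1) y = Pinf \<and> qphi Q i x = 0) \<and>
       (qphi Q (i - 1) x \<noteq> qphi Q (i - 1) y \<longrightarrow> qphi Q (i - 1) x \<noteq> 0)))"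

definition LQ3 :: "nat \<Rightarrow> 'a qc_data \<Rightarrow> bool" where
  "LQ3 n Q \<longleftrightarrow> (\<forall>i \<in> index_set n. \<forall>j \<in> index_set n. \<forall>x \<in> qset Q.
     i \<noteq> j \<and> qe Q i x \<noteq> None \<and> qe Q j x \<noteq> None \<longrightarrow>
       Option.bind (qe Q j x) (qe Q i) = Option.bind (qe Q i x) (qe Q j) \<and>
       Option.bind (qe Q j x) (qe Q i) \<noteq> None)"

definition LQ3' :: "nat \<Rightarrow> 'a qc_data \<Rightarrow> bool" where
  "LQ3' n Q \<longleftrightarrow> (\<forall>i \<in> index_set n. \<forall>j \<in> index_set n. \<forall>x \<in> qset Q.
     i \<noteq> j \<and> qf Q i x \<noteq> None \<and> qf Q j x \<noteq> None \<longrightarrow>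
       Option.bind (qf Q j x) (qf Q i) = Option.bind (qf Q i x) (qf Q j) \<and>
       Option.bind (qf Q j x) (qf Q i) \<noteq> None)"

definition quasi_tensor :: "nat \<Rightarrow> 'a qc_data \<Rightarrow> 'b qc_data \<Rightarrow> ('a \<times> 'b) qc_data" where
  "quasi_tensor n Q Q' = \<lparr>
     qset = qset Q \<times> qset Q',
     qe = (\<lambda>i (x, x').
       if qphi Q i x > 0 \<and> qeps Q' i x' > 0 then None
       else if qphi Q i x \<ge> qeps Q' i x' then map_option (\<lambda>y. (y, x')) (qe Q i x)
       else map_option (\<lambda>y'. (x, y')) (qe Q' i x')),
     qf = (\<lambda>i (x, x').
       if qphi Q i x > 0 \<and> qeps Q' i x' > 0 then None
       else if qphi Q i x > qeps Q' i x' then map_option (\<lambda>y. (y, x')) (qf Q i x)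
       else map_option (\<lambda>y'. (x, y')) (qf Q' i x')),
     qeps = (\<lambda>i (x, x').
       if qphi Q i x > 0 \<and> qeps Q' i x' > 0 then Pinf
       else max (qeps Q i x)
         (qeps Q' i x' - Fin (weight_inner n (qwt Q x) (simple_root i)))),
     qphi = (\<lambda>i (x, x').
       if qphi Q i x > 0 \<and> qeps Q' i x' > 0 then Pinf
       else max (qphi Q i x + Fin (weight_inner n (qwt Q' x') (simple_root i)))
         (qphi Q' i x')),
     qwt = (\<lambda>(x, x') k. qwt Q x k + qwt Q' x' k) \<rparr>"

end

theory Submission
  imports Defs
begin

text \<open>
  In a seminormal quasi-crystal every pair of string lengths \<open>(\<epsilon>\<^sub>i x, \<phi>\<^sub>i x)\<close> is either \<open>(\<infinity>, \<infinity>)\<close> or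
  consists of natural numbers, and \<open>e\<^sub>i x\<close> is defined iff \<open>\<epsilon>\<^sub>i x\<close> is finite and nonzero. In a
  product, \<open>\<epsilon>\<^sub>i\<close> and \<open>\<phi>\<^sub>i\<close> are infinite if \<open>\<phi>\<^sub>i x \<noteq> 0 \<noteq> \<epsilon>\<^sub>i x'\<close> and additive otherwise, which
  gives LQ1 at once. LQ1 and LQ2 together leave three possibilities for how the lengths at
  \<open>i \<plusminus> 1\<close> change along an \<open>i\<close>-edge: both stay infinite, both stay finite and one of them changes
  by one, or both jump between infinite and finite when a length at \<open>i\<close> becomes \<open>0\<close>. LQ2 for
  the product is a check of these cases. For LQ3 and LQ3' the point is that two applicable operators with
  different indices never change which tensor factor the other one acts on.
\<close>

section \<open>Weights and string lengths in a seminormal quasi-crystal\<close>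

lemma weight_inner_simple_root:
  assumes "i \<in> index_set n"
  shows "weight_inner n u (simple_root i) = u i - u (i + 1)"
proof -
  have "weight_inner n u (simple_root i)
      = (\<Sum>k = 1..n. (if k = i then u k else 0) - (if k = i + 1 then u k else 0))"
    unfolding weight_inner_def simple_root_def unit_weight_def by (intro sum.cong) auto
  also have "\<dots> = u i - u (i + 1)"
    using assms by (auto simp: sum_subtractf)
  finally show ?thesis .
qed

lemma partial_iter_None:
  assumes "g x = None"
  shows "{k. partial_iter g k x \<noteq> None} = {0}"
proof -
  have "partial_iter g k x = None" if "k > 0" for k
    using that
  proof (induction k)
    case (Suc k)
    then show ?case using assms by (cases k) (auto simp: partial_iter_def)
  qed simp
  moreover have "partial_iter g 0 x \<noteq> None" by (simp add: partial_iter_def)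
  ultimately show ?thesis by (metis (mono_tags, lifting) gr0I Collect_cong singleton_conv)
qed

context seminormal_quasi_crystal
begin

text \<open>Away from \<open>Pinf\<close>, seminormality makes both lengths maxima of sets of
  naturals, which rules out \<open>Minf\<close>. Q2 then forces the pairing to be
  \<open>b - a\<close>, and it also carries \<open>Pinf\<close> from \<open>qeps\<close> to
  \<open>qphi\<close>.\<close>

lemma eps_phi_cases:
  assumes "i \<in> index_set n" "x \<in> qset Q"
  obtains (Fin) a b where "qeps Q i x = Fin a" "qphi Q i x = Fin b" "0 \<le> a" "0 \<le> b"
      "weight_inner n (qwt Q x) (simple_root i) = b - a"
  | (Pinf) "qeps Q i x = Pinf" "qphi Q i x = Pinf"
proof (cases "qeps Q i x = Pinf")
  case True
  then show ?thesis using Q2[OF assms] Pinf by simp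
next
  case False
  show ?thesis
    using seminormal_eps[OF assms False] seminormal_phi[OF assms False] Q2[OF assms]
    by (auto intro!: Fin)
qed

text \<open>A finite length is 0 exactly if the first step already fails; at \<open>Pinf\<close> the
  operator is undefined by Q4.\<close>

lemma qe_eq_None_iff:
  assumes "i \<in> index_set n" "x \<in> qset Q"
  shows "qe Q i x = None \<longleftrightarrow> qeps Q i x = 0 \<or> qeps Q i x = Pinf"
proof (cases "qeps Q i x = Pinf")
  case False
  let ?S = "{k. partial_iter (qe Q i) k x \<noteq> None}"
  have S: "finite ?S" "qeps Q i x = Fin (int (Max ?S))"
    using seminormal_eps[OF assms False] by auto
  have "Max ?S \<ge> 1" if "qe Q i x \<noteq> None"
    using that S(1) by (intro Max_ge) (auto simp: partial_iter_def)
  moreover have "Max ?S = 0" if "qe Q i x = None"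
    using partial_iter_None[where g = "qe Q i", OF that] by simp
  ultimately show ?thesis using S(2) False
    by (cases "qe Q i x = None") (auto simp: zero_extended_def simp del: not_None_eq)
qed (use Q4[OF assms] in auto)

lemma qf_eq_None_iff:
  assumes "i \<in> index_set n" "x \<in> qset Q"
  shows "qf Q i x = None \<longleftrightarrow> qphi Q i x = 0 \<or> qphi Q i x = Pinf"
proof (cases "qeps Q i x = Pinf")
  case False
  let ?S = "{k. partial_iter (qf Q i) k x \<noteq> None}"
  have S: "finite ?S" "qphi Q i x = Fin (int (Max ?S))"
    using seminormal_phi[OF assms False] by auto
  have "Max ?S \<ge> 1" if "qf Q i x \<noteq> None"
    using that S(1) by (intro Max_ge) (auto simp: partial_iter_def)
  moreover have "Max ?S = 0" if "qf Q i x = None"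
    using partial_iter_None[where g = "qf Q i", OF that] by simp
  ultimately show ?thesis using S(2) False
    by (cases "qf Q i x = None") (auto simp: zero_extended_def simp del: not_None_eq)
next
  case True
  then show ?thesis using Q4[OF assms] by (cases rule: eps_phi_cases[OF assms]) auto
qed

lemma eps_nonneg: "0 \<le> qeps Q i x" if "i \<in> index_set n" "x \<in> qset Q"
  by (rule eps_phi_cases[OF that]) (auto simp: zero_extended_def)

lemma phi_nonneg: "0 \<le> qphi Q i x" if "i \<in> index_set n" "x \<in> qset Q"
  by (rule eps_phi_cases[OF that]) (auto simp: zero_extended_def)

text \<open>The increments are the entries of the Cartan matrix of type A. With Q2 they convert a
  change of one of \<open>qeps\<close>, \<open>qphi\<close> into a change of the other.\<close>

lemma weight_inner_e:
  assumes "i \<in> index_set n" "j \<in> index_set n" "x \<in> qset Q" "qe Q i x = Some y"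
  shows "weight_inner n (qwt Q y) (simple_root j) = weight_inner n (qwt Q x) (simple_root j)
    + (if i = j then 2 else if i = j + 1 \<or> j = i + 1 then - 1 else 0)"
  unfolding weight_inner_simple_root[OF assms(2)]
    Q1_wt[OF assms(1,3) e_closed[OF assms(1,3,4)] assms(4)]
  by (auto simp: simple_root_def unit_weight_def)

end

section \<open>String lengths at other indices along an edge\<close>

locale local_quasi_crystal = seminormal_quasi_crystal +
  assumes LQ1: "LQ1 n Q" and LQ2: "LQ2 n Q"
begin

lemma eps_zero_iff:
  "i \<in> index_set n \<Longrightarrow> i + 1 \<in> index_set n \<Longrightarrow> x \<in> qset Q \<Longrightarrow>
    qeps Q i x = 0 \<longleftrightarrow> qphi Q (i + 1) x = 0"
  using LQ1 unfolding LQ1_def by blast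

lemma e_far:
  assumes "i \<in> index_set n" "j \<in> index_set n" "x \<in> qset Q" "qe Q i x = Some y"
    and "i \<noteq> j" "j \<noteq> i + 1" "i \<noteq> j + 1"
  shows "qeps Q j y = qeps Q j x" "qphi Q j y = qphi Q j x"
proof -
  have y: "y \<in> qset Q" using assms e_closed by blast
  have "\<bar>int i - int j\<bar> > 1" using assms by auto
  then show *: "qeps Q j y = qeps Q j x"
    using LQ2[unfolded LQ2_def, rule_format, OF assms(1,3) y assms(4)] assms(2) by simp
  show "qphi Q j y = qphi Q j x"
    using Q2[OF assms(2,3)] Q2[OF assms(2) y] weight_inner_e[OF assms(1-4)] assms * by simp
qed

text \<open>By LQ2, \<open>qeps Q (i+1)\<close> changes only if it starts at \<open>Pinf\<close>. A
  finite value therefore stays, and as the pairing drops by 1, Q2 lowers \<open>qphi Q (i+1)\<close>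
  by 1. LQ1 at \<open>y\<close> links \<open>qeps Q i y = 0\<close> to the new \<open>qphi\<close>;
  the nonvanishing clause of LQ2 gives \<open>0 < a\<close> in the jump.\<close>

lemma e_succ_cases:
  assumes "i \<in> index_set n" "i + 1 \<in> index_set n" "x \<in> qset Q" "qe Q i x = Some y"
  obtains
    (Fin) a b where "qeps Q (i+1) x = Fin a" "qphi Q (i+1) x = Fin (b + 1)"
      "qeps Q (i+1) y = Fin a" "qphi Q (i+1) y = Fin b" "0 \<le> a" "0 \<le> b"
      "qeps Q i y = 0 \<longleftrightarrow> b = 0"
  | (Pinf) "qeps Q (i+1) x = Pinf" "qphi Q (i+1) x = Pinf"
      "qeps Q (i+1) y = Pinf" "qphi Q (i+1) y = Pinf" "qeps Q i y \<noteq> 0"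
  | (jump) a where "qeps Q (i+1) x = Pinf" "qphi Q (i+1) x = Pinf"
      "qeps Q (i+1) y = Fin a" "qphi Q (i+1) y = 0" "0 < a" "qeps Q i y = 0"
proof -
  have y: "y \<in> qset Q" using assms e_closed by blast
  note wt = weight_inner_e[OF assms]
  have 1: "(qeps Q (i + 1) x \<noteq> qeps Q (i + 1) y \<longleftrightarrow> qeps Q (i + 1) x = Pinf \<and> qeps Q i y = 0)"
    "qeps Q (i + 1) x \<noteq> qeps Q (i + 1) y \<longrightarrow> qeps Q (i + 1) y \<noteq> 0"
    using LQ2[unfolded LQ2_def, rule_format, OF assms(1,3) y assms(4)] assms(2) by blast+
  have 2: "qeps Q i y = 0 \<longleftrightarrow> qphi Q (i + 1) y = 0"
    using eps_zero_iff assms y by blast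
  show ?thesis
  proof (cases rule: eps_phi_cases[OF assms(2,3), case_names Fin Pinf])
    case (Fin a b)
    from 1 Fin have "qeps Q (i+1) y = Fin a" by auto
    moreover from this have "qphi Q (i+1) y = Fin (b - 1)" "0 \<le> b - 1"
      using wt Fin by (cases rule: eps_phi_cases[OF assms(2) y]; simp)+
    ultimately show ?thesis
      using that(1)[of a "b - 1"] Fin 2 by (simp add: zero_extended_def)
  next
    case Pinf
    note x = this
    show ?thesis
    proof (cases rule: eps_phi_cases[OF assms(2) y, case_names Fin Pinf])
      case (Fin a b)
      then show ?thesis using x 1 2 that(3)[of a] by (auto simp: zero_extended_def)
    next
      case Pinf
      then show ?thesis using x 1 2 that(2) by (auto simp: zero_extended_def)
    qed
  qed
qed

text \<open>Mirror image of \<open>e_succ_cases\<close>: \<open>x\<close> and \<open>y\<close> as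
  well as \<open>qeps\<close> and \<open>qphi\<close> swap roles. Labelling the edge
  \<open>i + 1\<close> keeps subtraction of naturals out of the statement.\<close>

lemma e_pred_cases:
  assumes "i + 1 \<in> index_set n" "i \<in> index_set n" "x \<in> qset Q" "qe Q (i + 1) x = Some y"
  obtains
    (Fin) a b where "qeps Q i x = Fin a" "qphi Q i x = Fin b"
      "qeps Q i y = Fin (a + 1)" "qphi Q i y = Fin b" "0 \<le> a" "0 \<le> b"
      "qphi Q (i + 1) x = 0 \<longleftrightarrow> a = 0"
  | (Pinf) "qeps Q i x = Pinf" "qphi Q i x = Pinf"
      "qeps Q i y = Pinf" "qphi Q i y = Pinf" "qphi Q (i + 1) x \<noteq> 0"
  | (jump) b where "qeps Q i x = 0" "qphi Q i x = Fin b"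
      "qeps Q i y = Pinf" "qphi Q i y = Pinf" "0 < b" "qphi Q (i + 1) x = 0"
proof -
  have y: "y \<in> qset Q" using assms e_closed by blast
  note wt = weight_inner_e[OF assms]
  have 1: "(qphi Q i x \<noteq> qphi Q i y \<longleftrightarrow> qphi Q i y = Pinf \<and> qphi Q (i + 1) x = 0)"
    "qphi Q i x \<noteq> qphi Q i y \<longrightarrow> qphi Q i x \<noteq> 0"
    using LQ2[unfolded LQ2_def, rule_format, OF assms(1,3) y assms(4)] assms(2)
    unfolding add_diff_cancel_right' by blast+
  have 2: "qeps Q i x = 0 \<longleftrightarrow> qphi Q (i + 1) x = 0"
    using eps_zero_iff assms by blast
  show ?thesis
  proof (cases rule: eps_phi_cases[OF assms(2) y, case_names Fin Pinf])
    case (Fin a b)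
    from 1 Fin have "qphi Q i x = Fin b" by auto
    moreover from this have "qeps Q i x = Fin (a - 1)" "0 \<le> a - 1"
      using wt Fin by (cases rule: eps_phi_cases[OF assms(2,3)]; simp)+
    ultimately show ?thesis
      using that(1)[of "a - 1" b] Fin 2 by (simp add: zero_extended_def)
  next
    case Pinf
    note y' = this
    show ?thesis
    proof (cases rule: eps_phi_cases[OF assms(2,3), case_names Fin Pinf])
      case (Fin a b)
      then show ?thesis using y' 1 2 that(3)[of b] by (auto simp: zero_extended_def)
    next
      case Pinf
      then show ?thesis using y' 1 2 that(2) by (auto simp: zero_extended_def)
    qed
  qed
qed

end

section \<open>The quasi-tensor product in simplified form, and LQ1\<close>

locale local_quasi_crystal_pair =
  L: local_quasi_crystal n Q + R: local_quasi_crystal n Q'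
  for n :: nat and Q :: "'a qc_data" and Q' :: "'b qc_data"
begin

abbreviation T :: "('a \<times> 'b) qc_data" where "T \<equiv> quasi_tensor n Q Q'"

lemma qset_T: "qset T = qset Q \<times> qset Q'"
  by (simp add: quasi_tensor_def)

text \<open>Unless it is infinite by definition, one of the two strings that meet in the middle is
  empty, and then both maxima in the definition of the product collapse to sums.\<close>

lemma eps_T:
  assumes "i \<in> index_set n" "x \<in> qset Q" "x' \<in> qset Q'"
  shows "qeps T i (x, x') =
    (if qphi Q i x \<noteq> 0 \<and> qeps Q' i x' \<noteq> 0 then Pinf else qeps Q i x + qeps Q' i x')"
  by (cases rule: L.eps_phi_cases[OF assms(1,2)]; cases rule: R.eps_phi_cases[OF assms(1,3)])
    (auto simp: quasi_tensor_def zero_extended_def)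

lemma phi_T:
  assumes "i \<in> index_set n" "x \<in> qset Q" "x' \<in> qset Q'"
  shows "qphi T i (x, x') =
    (if qphi Q i x \<noteq> 0 \<and> qeps Q' i x' \<noteq> 0 then Pinf else qphi Q i x + qphi Q' i x')"
  by (cases rule: L.eps_phi_cases[OF assms(1,2)]; cases rule: R.eps_phi_cases[OF assms(1,3)])
    (auto simp: quasi_tensor_def zero_extended_def)

text \<open>Unless both middle lengths are nonzero, comparing them amounts to testing for 0. If both
  are 0, \<open>qe\<close> acts on the left factor but \<open>qf\<close> on the right one, hence the
  opposite order of the tests in \<open>f_T\<close>.\<close>

lemma e_T:
  assumes "i \<in> index_set n" "x \<in> qset Q" "x' \<in> qset Q'"
  shows "qe T i (x, x') =
    (if qeps Q' i x' = 0 then map_option (\<lambda>y. (y, x')) (qe Q i x)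
     else if qphi Q i x = 0 then map_option (\<lambda>y'. (x, y')) (qe Q' i x') else None)"
  by (cases rule: L.eps_phi_cases[OF assms(1,2)]; cases rule: R.eps_phi_cases[OF assms(1,3)])
    (auto simp: quasi_tensor_def zero_extended_def)

lemma f_T:
  assumes "i \<in> index_set n" "x \<in> qset Q" "x' \<in> qset Q'"
  shows "qf T i (x, x') =
    (if qphi Q i x = 0 then map_option (\<lambda>y'. (x, y')) (qf Q' i x')
     else if qeps Q' i x' = 0 then map_option (\<lambda>y. (y, x')) (qf Q i x) else None)"
  by (cases rule: L.eps_phi_cases[OF assms(1,2)]; cases rule: R.eps_phi_cases[OF assms(1,3)])
    (auto simp: quasi_tensor_def zero_extended_def)

lemma LQ1_T: "LQ1 n T"
proof -
  have "qeps T i (x, x') = 0 \<longleftrightarrow> qphi T (i + 1) (x, x') = 0"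
    if i: "i \<in> index_set n" "i + 1 \<in> index_set n" and x: "x \<in> qset Q" "x' \<in> qset Q'" for i x x'
  proof -
    \<comment> \<open>The summands are nonnegative, so their sum vanishes only if both do; the
      \<open>Pinf\<close> branch has \<open>qeps Q' i x' \<noteq> 0\<close>, so both sides are false
      there.\<close>
    have "qeps T i (x, x') = 0 \<longleftrightarrow> qeps Q i x = 0 \<and> qeps Q' i x' = 0"
      unfolding eps_T[OF i(1) x]
      by (cases rule: L.eps_phi_cases[OF i(1) x(1)]; cases rule: R.eps_phi_cases[OF i(1) x(2)])
        (auto simp: zero_extended_def)
    moreover have "qphi T (i+1) (x, x') = 0 \<longleftrightarrow> qphi Q (i+1) x = 0 \<and> qphi Q' (i+1) x' = 0"
      unfolding phi_T[OF i(2) x]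
      by (cases rule: L.eps_phi_cases[OF i(2) x(1)]; cases rule: R.eps_phi_cases[OF i(2) x(2)])
        (auto simp: zero_extended_def)
    ultimately show ?thesis
      using L.eps_zero_iff[OF i x(1)] R.eps_zero_iff[OF i x(2)] by simp
  qed
  then show ?thesis unfolding LQ1_def qset_T by auto
qed

section \<open>Edges of the product, and LQ2\<close>

lemma e_T_cases:
  assumes "i \<in> index_set n" "x \<in> qset Q" "x' \<in> qset Q'" "qe T i (x, x') = Some z"
  obtains (left) y where "z = (y, x')" "qe Q i x = Some y" "y \<in> qset Q" "qeps Q' i x' = 0"
    | (right) y' where "z = (x, y')" "qe Q' i x' = Some y'" "y' \<in> qset Q'" "qphi Q i x = 0"
        "qeps Q' i x' \<noteq> 0"
  using assms(4) L.e_closed[OF assms(1,2)] R.e_closed[OF assms(1,3)] left right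
  unfolding e_T[OF assms(1-3)] by (auto split: if_splits)

lemma f_T_cases:
  assumes "i \<in> index_set n" "x \<in> qset Q" "x' \<in> qset Q'" "qf T i (x, x') = Some z"
  obtains (left) y where "z = (y, x')" "qf Q i x = Some y" "y \<in> qset Q" "qeps Q' i x' = 0"
        "qphi Q i x \<noteq> 0"
    | (right) y' where "z = (x, y')" "qf Q' i x' = Some y'" "y' \<in> qset Q'" "qphi Q i x = 0"
  using assms(4) L.f_closed[OF assms(1,2)] R.f_closed[OF assms(1,3)] left right
  unfolding f_T[OF assms(1-3)] by (auto split: if_splits)

lemma e_T_far:
  assumes i: "i \<in> index_set n" "j \<in> index_set n" and x: "x \<in> qset Q" "x' \<in> qset Q'"
    and e: "qe T i (x, x') = Some z" and ij: "i \<noteq> j" "j \<noteq> i + 1" "i \<noteq> j + 1"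
  shows "qeps T j z = qeps T j (x, x')"
proof (cases rule: e_T_cases[OF i(1) x e, case_names left right])
  case (left y)
  then show ?thesis using L.e_far[OF i x(1) left(2) ij] x by (simp add: eps_T[OF i(2)])
next
  case (right y')
  then show ?thesis using R.e_far[OF i x(2) right(2) ij] x by (simp add: eps_T[OF i(2)])
qed

lemma e_T_succ:
  assumes i: "i \<in> index_set n" "i + 1 \<in> index_set n" and x: "x \<in> qset Q" "x' \<in> qset Q'"
    and e: "qe T i (x, x') = Some z"
  shows "(qeps T (i+1) (x, x') \<noteq> qeps T (i+1) z \<longleftrightarrow> qeps T (i+1) (x, x') = Pinf \<and> qeps T i z = 0)
    \<and> (qeps T (i+1) (x, x') \<noteq> qeps T (i+1) z \<longrightarrow> qeps T (i+1) z \<noteq> 0)"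
proof (cases rule: e_T_cases[OF i(1) x e, case_names left right])
  case (left y)
  \<comment> \<open>So the lengths of \<open>x'\<close> at \<open>i+1\<close> are finite. A finite
    edge of the left factor becomes a jump of the product if \<open>qeps Q' (i+1) x'\<close> is
    nonzero and \<open>qphi Q (i+1)\<close> falls from 1 to 0, which is when
    \<open>qeps Q i y = 0\<close>.\<close>
  have "qphi Q' (i+1) x' = 0" using R.eps_zero_iff[OF i x(2)] left by simp
  moreover have "qeps T i z = qeps Q i y"
    using left x by (simp add: eps_T[OF i(1)] del: One_nat_def)
  ultimately show ?thesis
    using left(1,3) x
    by (cases rule: L.e_succ_cases[OF i x(1) left(2)];
        cases rule: R.eps_phi_cases[OF i(2) x(2)])
      (auto simp: eps_T[OF i(2)] zero_extended_def simp del: One_nat_def)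
next
  case (right y')
  \<comment> \<open>This decides whether a jump in the right factor survives: if
    \<open>qeps Q i x\<close> is nonzero, so is \<open>qphi Q (i+1) x\<close>, and the product stays
    at \<open>Pinf\<close> because \<open>0 < a\<close>.\<close>
  have "qeps Q i x = 0 \<longleftrightarrow> qphi Q (i+1) x = 0" using L.eps_zero_iff[OF i x(1)] .
  moreover have "qeps T i z = qeps Q i x + qeps Q' i y'"
    using right x by (simp add: eps_T[OF i(1)] del: One_nat_def)
  ultimately show ?thesis
    using right(1,3,4) x R.eps_nonneg[OF i(1) right(3)]
    by (cases rule: R.e_succ_cases[OF i x(2) right(2)];
        cases rule: L.eps_phi_cases[OF i(2) x(1)];
        cases rule: L.eps_phi_cases[OF i(1) x(1)]; cases "qeps Q' i y'")
      (auto simp: eps_T[OF i(2)] zero_extended_def simp del: One_nat_def)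
qed

text \<open>The factors swap roles compared with \<open>e_T_succ\<close>: a finite edge on the right
  can become a jump to \<open>Pinf\<close>, when \<open>qeps Q' i\<close> rises from 0 and
  \<open>qphi Q i x\<close> is nonzero; a jump on the left survives only if
  \<open>qeps Q' i x' = 0\<close>.\<close>

lemma e_T_pred:
  assumes i: "i + 1 \<in> index_set n" "i \<in> index_set n" and x: "x \<in> qset Q" "x' \<in> qset Q'"
    and e: "qe T (i+1) (x, x') = Some z"
  shows "(qphi T i (x, x') \<noteq> qphi T i z \<longleftrightarrow> qphi T i z = Pinf \<and> qphi T (i+1) (x, x') = 0)
    \<and> (qphi T i (x, x') \<noteq> qphi T i z \<longrightarrow> qphi T i (x, x') \<noteq> 0)"
proof (cases rule: e_T_cases[OF i(1) x e, case_names left right])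
  case (left y)
  have "qeps Q' i x' = 0 \<longleftrightarrow> qphi Q' (i+1) x' = 0" using R.eps_zero_iff[OF i(2,1) x(2)] .
  moreover have "qphi T (i+1) (x, x') = qphi Q (i+1) x + qphi Q' (i+1) x'"
    using left x by (simp add: phi_T[OF i(1)] del: One_nat_def)
  ultimately show ?thesis
    using left(1,3) x L.phi_nonneg[OF i(1) x(1)]
    by (cases rule: L.e_pred_cases[OF i x(1) left(2)];
        cases rule: R.eps_phi_cases[OF i(2) x(2)];
        cases rule: R.eps_phi_cases[OF i(1) x(2)]; cases "qphi Q (i+1) x")
      (auto simp: phi_T[OF i(2)] zero_extended_def simp del: One_nat_def)
next
  case (right y')
  have "qeps Q i x = 0" using L.eps_zero_iff[OF i(2,1) x(1)] right by simp
  moreover have "qphi T (i+1) (x, x') = qphi Q' (i+1) x'"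
    using right x by (simp add: phi_T[OF i(1)] del: One_nat_def)
  ultimately show ?thesis
    using right(1,3) x
    by (cases rule: R.e_pred_cases[OF i x(2) right(2)];
        cases rule: L.eps_phi_cases[OF i(2) x(1)])
      (auto simp: phi_T[OF i(2)] zero_extended_def simp del: One_nat_def)
qed

lemma LQ2_T: "LQ2 n T"
  unfolding LQ2_def
proof (intro ballI impI)
  fix i z w
  assume i: "i \<in> index_set n" and z: "z \<in> qset T" and e: "qe T i z = Some w"
  obtain x x' where x: "z = (x, x')" "x \<in> qset Q" "x' \<in> qset Q'"
    using z by (auto simp: qset_T)
  note e' = e[unfolded x(1)]
  have "qeps T j z = qeps T j w" if "j \<in> index_set n" "\<bar>int i - int j\<bar> > 1" for j
    using e_T_far[OF i that(1) x(2,3) e'] that x(1) by auto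
  moreover note e_T_succ[OF i _ x(2,3) e']
  moreover have "(qphi T (i-1) z \<noteq> qphi T (i-1) w \<longleftrightarrow> qphi T (i-1) w = Pinf \<and> qphi T i z = 0)
      \<and> (qphi T (i-1) z \<noteq> qphi T (i-1) w \<longrightarrow> qphi T (i-1) z \<noteq> 0)" if "i - 1 \<in> index_set n"
  proof -
    \<comment> \<open>Indices start at 1, so the subtraction is not truncated.\<close>
    have "i - 1 + 1 = i" using i by auto
    then show ?thesis using e_T_pred[of "i - 1" x x' w] i that x e by metis
  qed
  ultimately show "(\<forall>j \<in> index_set n. \<bar>int i - int j\<bar> > 1 \<longrightarrow> qeps T j z = qeps T j w) \<and>
     (i + 1 \<in> index_set n \<longrightarrow>
       (qeps T (i + 1) z \<noteq> qeps T (i + 1) w \<longleftrightarrow> qeps T (i + 1) z = Pinf \<and> qeps T i w = 0) \<and>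
       (qeps T (i + 1) z \<noteq> qeps T (i + 1) w \<longrightarrow> qeps T (i + 1) w \<noteq> 0)) \<and>
     (i - 1 \<in> index_set n \<longrightarrow>
       (qphi T (i - 1) z \<noteq> qphi T (i - 1) w \<longleftrightarrow> qphi T (i - 1) w = Pinf \<and> qphi T i z = 0) \<and>
       (qphi T (i - 1) z \<noteq> qphi T (i - 1) w \<longrightarrow> qphi T (i - 1) z \<noteq> 0))"
    unfolding x(1) by blast
qed

section \<open>Commutation of operators: LQ3 and LQ3'\<close>

text \<open>If \<open>e\<^sub>i\<close> acts on the left factor and \<open>e\<^sub>j\<close> on the right one, neither action moves the other
  to a different factor; the case \<open>j = i + 1\<close> cannot occur by LQ1.\<close>

lemma e_mixed:
  assumes i: "i \<in> index_set n" "j \<in> index_set n" "i \<noteq> j" and x: "x \<in> qset Q" "x' \<in> qset Q'"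
    and e: "qe Q i x = Some y" "qe Q' j x' = Some y'"
    and 0: "qeps Q' i x' = 0" "qphi Q j x = 0"
  shows "qphi Q j y = 0" "qeps Q' i y' = 0"
proof -
  \<comment> \<open>Otherwise \<open>qphi Q j x = 0\<close> would give
    \<open>qeps Q i x = 0\<close>, and \<open>qe Q i x\<close> would be undefined.\<close>
  have "j \<noteq> i + 1"
    using L.eps_zero_iff[OF i(1) _ x(1)] L.qe_eq_None_iff[OF i(1) x(1)] i e 0 by auto
  then consider "i = j + 1" | "i \<noteq> j + 1" "j \<noteq> i + 1" by blast
  then have "qphi Q j y = 0 \<and> qeps Q' i y' = 0"
  proof cases
    case 1
    \<comment> \<open>A finite edge keeps \<open>qphi Q j\<close>; a jump would need it to be
      positive at \<open>x\<close>.\<close>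
    have "qphi Q j y = 0"
      using 0 by (cases rule: L.e_pred_cases[OF i(1)[unfolded 1] i(2) x(1) e(1)[unfolded 1]])
        (auto simp: zero_extended_def)
    moreover have "qeps Q' i y' = 0"
      using 0 1 by (cases rule: R.e_succ_cases[OF i(2) i(1)[unfolded 1] x(2) e(2)])
        (auto simp: zero_extended_def)
    ultimately show ?thesis ..
  next
    case 2
    then show ?thesis using L.e_far[OF i(1,2) x(1) e(1)] R.e_far[OF i(2,1) x(2) e(2)] i 0 by simp
  qed
  then show "qphi Q j y = 0" "qeps Q' i y' = 0" by auto
qed

text \<open>Reversing the edges by Q1 makes the case analysis for \<open>qe\<close> available, now
  with the known zeros at the endpoints \<open>x\<close> and \<open>x'\<close>. Here
  \<open>j = i + 1\<close> is excluded in the right factor: \<open>qphi Q' j x'\<close> would be 0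
  and \<open>qf Q' j x'\<close> undefined.\<close>

lemma f_mixed:
  assumes i: "i \<in> index_set n" "j \<in> index_set n" "i \<noteq> j" and x: "x \<in> qset Q" "x' \<in> qset Q'"
    and f: "qf Q i x = Some y" "qf Q' j x' = Some y'"
    and 0: "qeps Q' i x' = 0" "qphi Q j x = 0"
  shows "qphi Q j y = 0" "qeps Q' i y' = 0"
proof -
  have y: "y \<in> qset Q" "y' \<in> qset Q'"
    using L.f_closed[OF i(1) x(1) f(1)] R.f_closed[OF i(2) x(2) f(2)] by auto
  have e: "qe Q i y = Some x" "qe Q' j y' = Some x'"
    using L.Q1_iff[OF i(1) y(1) x(1)] R.Q1_iff[OF i(2) y(2) x(2)] f by auto
  have "j \<noteq> i + 1"
    using R.eps_zero_iff[OF i(1) _ x(2)] R.qf_eq_None_iff[OF i(2) x(2)] i f 0 by auto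
  then consider "i = j + 1" | "i \<noteq> j + 1" "j \<noteq> i + 1" by blast
  then have "qphi Q j y = 0 \<and> qeps Q' i y' = 0"
  proof cases
    case 1
    have "qphi Q j y = 0"
      using 0 by (cases rule: L.e_pred_cases[OF i(1)[unfolded 1] i(2) y(1) e(1)[unfolded 1]])
        (auto simp: zero_extended_def)
    moreover have "qeps Q' i y' = 0"
      using 0 1 by (cases rule: R.e_succ_cases[OF i(2) i(1)[unfolded 1] y(2) e(2)])
        (auto simp: zero_extended_def)
    ultimately show ?thesis ..
  next
    case 2
    then show ?thesis using L.e_far[OF i(1,2) y(1) e(1)] R.e_far[OF i(2,1) y(2) e(2)] i 0 by simp
  qed
  then show "qphi Q j y = 0" "qeps Q' i y' = 0" by auto
qed

text \<open>If both operators act on one factor, LQ3 there closes the square; if they act on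
  different factors, \<open>e_mixed\<close> keeps each in its own factor, so both orders give the
  same pair.\<close>

lemma LQ3_T:
  assumes "LQ3 n Q" "LQ3 n Q'"
  shows "LQ3 n T"
proof -
  have "Option.bind (qe T j (x, x')) (qe T i) = Option.bind (qe T i (x, x')) (qe T j) \<and>
      Option.bind (qe T j (x, x')) (qe T i) \<noteq> None"
    if i: "i \<in> index_set n" "j \<in> index_set n" "i \<noteq> j" and x: "x \<in> qset Q" "x' \<in> qset Q'"
      and ne: "qe T i (x, x') \<noteq> None" "qe T j (x, x') \<noteq> None" for i j x x'
  proof -
    obtain z w where z: "qe T i (x, x') = Some z" and w: "qe T j (x, x') = Some w"
      using ne by blast
    have L3: "Option.bind (qe Q j x) (qe Q i) = Option.bind (qe Q i x) (qe Q j) \<and>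
       Option.bind (qe Q j x) (qe Q i) \<noteq> None" if "qe Q i x \<noteq> None" "qe Q j x \<noteq> None"
      using assms(1) i x that unfolding LQ3_def by blast
    have R3: "Option.bind (qe Q' j x') (qe Q' i) = Option.bind (qe Q' i x') (qe Q' j) \<and>
       Option.bind (qe Q' j x') (qe Q' i) \<noteq> None" if "qe Q' i x' \<noteq> None" "qe Q' j x' \<noteq> None"
      using assms(2) i x that unfolding LQ3_def by blast
    show ?thesis
    proof (cases rule: e_T_cases[OF i(1) x z, case_names left right])
      case z: (left y)
      show ?thesis
      proof (cases rule: e_T_cases[OF i(2) x w, case_names left right])
        case w: (left u)
        from L3 z w obtain v where "qe Q j y = Some v" "qe Q i u = Some v" by fastforce
        then show ?thesis using z w x by (auto simp: e_T[OF i(1)] e_T[OF i(2)])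
      next
        case w: (right u')
        note m = e_mixed[OF i x z(2) w(2) z(4) w(4)]
        show ?thesis using z w x m by (auto simp: e_T[OF i(1)] e_T[OF i(2)])
      qed
    next
      case z: (right y')
      show ?thesis
      proof (cases rule: e_T_cases[OF i(2) x w, case_names left right])
        case w: (left u)
        note m = e_mixed[OF i(2,1) i(3)[symmetric] x w(2) z(2) w(4) z(4)]
        show ?thesis using z w x m by (auto simp: e_T[OF i(1)] e_T[OF i(2)])
      next
        case w: (right u')
        from R3 z w obtain v where v: "qe Q' j y' = Some v" "qe Q' i u' = Some v" by fastforce
        \<comment> \<open>At length 0 the second operator would move to the left factor; that it is
          defined on the right excludes this.\<close>
        then have "qeps Q' j y' \<noteq> 0" "qeps Q' i u' \<noteq> 0"
          using R.qe_eq_None_iff[OF i(2) z(3)] R.qe_eq_None_iff[OF i(1) w(3)] by auto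
        then show ?thesis using v z w x by (auto simp: e_T[OF i(1)] e_T[OF i(2)])
      qed
    qed
  qed
  then show ?thesis unfolding LQ3_def qset_T by blast
qed

text \<open>As for LQ3, with \<open>f_mixed\<close>. Since \<open>qf\<close> resolves ties to the
  right, the check that the second operator stays in its factor now falls on the case where both act
  on the left.\<close>

lemma LQ3'_T:
  assumes "LQ3' n Q" "LQ3' n Q'"
  shows "LQ3' n T"
proof -
  have "Option.bind (qf T j (x, x')) (qf T i) = Option.bind (qf T i (x, x')) (qf T j) \<and>
      Option.bind (qf T j (x, x')) (qf T i) \<noteq> None"
    if i: "i \<in> index_set n" "j \<in> index_set n" "i \<noteq> j" and x: "x \<in> qset Q" "x' \<in> qset Q'"
      and ne: "qf T i (x, x') \<noteq> None" "qf T j (x, x') \<noteq> None" for i j x x'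
  proof -
    obtain z w where z: "qf T i (x, x') = Some z" and w: "qf T j (x, x') = Some w"
      using ne by blast
    have L3: "Option.bind (qf Q j x) (qf Q i) = Option.bind (qf Q i x) (qf Q j) \<and>
       Option.bind (qf Q j x) (qf Q i) \<noteq> None" if "qf Q i x \<noteq> None" "qf Q j x \<noteq> None"
      using assms(1) i x that unfolding LQ3'_def by blast
    have R3: "Option.bind (qf Q' j x') (qf Q' i) = Option.bind (qf Q' i x') (qf Q' j) \<and>
       Option.bind (qf Q' j x') (qf Q' i) \<noteq> None" if "qf Q' i x' \<noteq> None" "qf Q' j x' \<noteq> None"
      using assms(2) i x that unfolding LQ3'_def by blast
    show ?thesis
    proof (cases rule: f_T_cases[OF i(1) x z, case_names left right])
      case z: (left y)
      show ?thesis
      proof (cases rule: f_T_cases[OF i(2) x w, case_names left right])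
        case w: (left u)
        from L3 z w obtain v where v: "qf Q j y = Some v" "qf Q i u = Some v" by fastforce
        then have "qphi Q j y \<noteq> 0" "qphi Q i u \<noteq> 0"
          using L.qf_eq_None_iff[OF i(2) z(3)] L.qf_eq_None_iff[OF i(1) w(3)] by auto
        then show ?thesis using v z w x by (auto simp: f_T[OF i(1)] f_T[OF i(2)])
      next
        case w: (right u')
        note m = f_mixed[OF i x z(2) w(2) z(4) w(4)]
        show ?thesis using z w x m by (auto simp: f_T[OF i(1)] f_T[OF i(2)])
      qed
    next
      case z: (right y')
      show ?thesis
      proof (cases rule: f_T_cases[OF i(2) x w, case_names left right])
        case w: (left u)
        note m = f_mixed[OF i(2,1) i(3)[symmetric] x w(2) z(2) w(4) z(4)]
        show ?thesis using z w x m by (auto simp: f_T[OF i(1)] f_T[OF i(2)])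
      next
        case w: (right u')
        from R3 z w obtain v where "qf Q' j y' = Some v" "qf Q' i u' = Some v" by fastforce
        then show ?thesis using z w x by (auto simp: f_T[OF i(1)] f_T[OF i(2)])
      qed
    qed
  qed
  then show ?thesis unfolding LQ3'_def qset_T by blast
qed

end

theorem theorem3p13:
  fixes n :: nat and Q :: "'a qc_data" and Q' :: "'b qc_data"
  assumes "n \<ge> 2"
    and "seminormal_quasi_crystal n Q"
    and "seminormal_quasi_crystal n Q'"
    and "LQ1 n Q" and "LQ2 n Q" and "LQ3 n Q" and "LQ3' n Q"
    and "LQ1 n Q'" and "LQ2 n Q'" and "LQ3 n Q'" and "LQ3' n Q'"
  shows "LQ1 n (quasi_tensor n Q Q') \<and> LQ2 n (quasi_tensor n Q Q') \<and>
    LQ3 n (quasi_tensor n Q Q') \<and> LQ3' n (quasi_tensor n Q Q')"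
proof -
  interpret local_quasi_crystal_pair n Q Q'
    using assms by (simp add: local_quasi_crystal_pair_def local_quasi_crystal_def
        local_quasi_crystal_axioms_def)
  show ?thesis using LQ1_T LQ2_T LQ3_T LQ3'_T assms by blast
qed

end
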